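(* Let $G$ be a finite simple connected graph with edges $e_1,\dots,e_m$ and let $x\in P(G)$ be such that $\tau(x)\ne0$. Then $x$ is a critical point of the weighted tree number $\tau$ on $P(G)$ if and only if the effective resistances of all the edges of $G(x)$ are the same.
   Context: The weighted edge polytope is $P(G)=\{(x_1,\dots,x_m): x_j\ge 0,\ \sum_{j=1}^m x_j=m\}$; $G(x)$ is $G$ with weight $x_j$ on $e_j$. The weighted tree number is $\tau(x)=\sum_{T}\prod_{e_j\in T}x_j$, the sum being over all spanning trees $T$ of $G$ (equivalently, any cofactor of the weighted Laplacian matrix). Put $\tau_j=\partial\tau/\partial x_j$, the polynomial $\tau$ being regarded as a function of $m$ independent variables. The effective resistance of $e_j$ in $G(x)$ is $\tau_j(x)/\tau(x)$. A point $x\in P(G)$ is critical for $\tau$ if the directional derivative of $\tau$ at $x$ vanishes in every direction $y\in\mathbf{R}^m$ with $\sum_j y_j=0$ (the Lagrange condition for the constraint $\sum_j x_j=m$). *)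

theory Defs
  imports "HOL-Analysis.Analysis"
begin

text \<open>A graph is a pair of a vertex set \<open>V\<close> and an edge set \<open>E\<close>, an edge being the set of its
  two endpoints.\<close>

definition simple_graph :: "'a set \<Rightarrow> 'a set set \<Rightarrow> bool" where
  "simple_graph V E \<longleftrightarrow> E \<subseteq> {{u, v} | u v. u \<in> V \<and> v \<in> V \<and> u \<noteq> v}"

text \<open>A connected graph is required to be nonempty.\<close>

definition connected_graph :: "'a set \<Rightarrow> 'a set set \<Rightarrow> bool" where
  "connected_graph V E \<longleftrightarrow> V \<noteq> {} \<and> (\<forall>u\<in>V. \<forall>v\<in>V. (u, v) \<in> {(a, b). {a, b} \<in> E}\<^sup>*)"

text \<open>A cycle is given by its list of distinct vertices, the last one being joined to the first.\<close>

definition graph_cycle :: "'a set set \<Rightarrow> 'a list \<Rightarrow> bool" where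
  "graph_cycle E p \<longleftrightarrow> 3 \<le> length p \<and> distinct p \<and>
     (\<forall>i<length p. {p ! i, p ! (Suc i mod length p)} \<in> E)"

definition tree_graph :: "'a set \<Rightarrow> 'a set set \<Rightarrow> bool" where
  "tree_graph V E \<longleftrightarrow> simple_graph V E \<and> connected_graph V E \<and> (\<nexists>p. graph_cycle E p)"

text \<open>A spanning tree contains all vertices, so it is identified with its edge set.\<close>

definition spanning_trees :: "'a set \<Rightarrow> 'a set set \<Rightarrow> 'a set set set" where
  "spanning_trees V E = {T. T \<subseteq> E \<and> tree_graph V T}"

text \<open>Points of \<open>\<real>\<^sup>m\<close> are indexed by the edges themselves instead of by \<open>1, \<dots>, m\<close>: they are
  functions on edges, of which only the values on \<open>E\<close> matter, and \<open>m = card E\<close>.\<close>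

definition edge_polytope :: "'a set set \<Rightarrow> ('a set \<Rightarrow> real) set" where
  "edge_polytope E = {x. (\<forall>e\<in>E. 0 \<le> x e) \<and> (\<Sum>e\<in>E. x e) = real (card E)}"

definition weighted_tree_number :: "'a set \<Rightarrow> 'a set set \<Rightarrow> ('a set \<Rightarrow> real) \<Rightarrow> real" where
  "weighted_tree_number V E x = (\<Sum>T\<in>spanning_trees V E. \<Prod>e\<in>T. x e)"

definition tree_number_partial ::
    "'a set \<Rightarrow> 'a set set \<Rightarrow> 'a set \<Rightarrow> ('a set \<Rightarrow> real) \<Rightarrow> real" where
  "tree_number_partial V E e x = deriv (\<lambda>t. weighted_tree_number V E (x(e := t))) (x e)"

definition effective_resistance ::
    "'a set \<Rightarrow> 'a set set \<Rightarrow> ('a set \<Rightarrow> real) \<Rightarrow> 'a set \<Rightarrow> real" where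
  "effective_resistance V E x e = tree_number_partial V E e x / weighted_tree_number V E x"

text \<open>The directional derivative is two-sided and taken in the ambient space, also at boundary
  points of the polytope.\<close>

definition critical_tree_number :: "'a set \<Rightarrow> 'a set set \<Rightarrow> ('a set \<Rightarrow> real) \<Rightarrow> bool" where
  "critical_tree_number V E x \<longleftrightarrow>
     x \<in> edge_polytope E \<and>
     (\<forall>y. (\<Sum>e\<in>E. y e) = 0 \<longrightarrow>
        ((\<lambda>t. weighted_tree_number V E (\<lambda>e. x e + t * y e)) has_real_derivative 0) (at 0))"

end

theory Submission imports Defs begin

text \<open>By the chain rule, the derivative of \<tau> at \<open>x\<close> in direction
  \<open>y\<close> is the inner product of \<open>y\<close> with the gradient of \<tau>
  (\<open>has_real_derivative_weighted_tree_number_direction\<close>). Hence \<open>x\<close> is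
  critical iff this gradient is orthogonal to the hyperplane of vectors with coordinate sum 0, that
  is, iff it is a multiple of the all-ones vector (\<open>orthogonal_sum_zero_iff_constant\<close>).
  Dividing the equal partial derivatives by the nonzero number \<tau>(x) turns them into equal
  effective resistances, and conversely.\<close>

lemma finite_simple_graph_edges:
  assumes "finite V" "simple_graph V E"
  shows "finite E"
proof -
  have "E \<subseteq> Pow V"
    using assms(2) by (auto simp: simple_graph_def)
  then show ?thesis
    using assms(1) by (meson finite_Pow_iff finite_subset)
qed

text \<open>The formal partial derivative of \<tau>: its monomials are square-free, so only the
  trees through \<open>e\<close> survive, each losing its factor \<open>x e\<close>. Deleting the
  factor instead of dividing by it also covers \<open>x e = 0\<close>.\<close>

definition tree_number_grad :: "'a set \<Rightarrow> 'a set set \<Rightarrow> ('a set \<Rightarrow> real) \<Rightarrow> 'a set \<Rightarrow> real" where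
  "tree_number_grad V E x e = (\<Sum>T | T \<in> spanning_trees V E \<and> e \<in> T. \<Prod>f\<in>T - {e}. x f)"

text \<open>The chain rule along an arbitrary curve \<open>g\<close>, so that coordinate lines (for
  the partial derivatives) and straight lines in direction \<open>y\<close> are both instances. It
  follows from the product rule for each tree.\<close>

lemma has_real_derivative_weighted_tree_number:
  fixes g :: "real \<Rightarrow> 'a set \<Rightarrow> real"
  assumes "finite E"
    and g: "\<And>e. e \<in> E \<Longrightarrow> ((\<lambda>t. g t e) has_real_derivative g' e) (at t\<^sub>0)"
  shows "((\<lambda>t. weighted_tree_number V E (g t)) has_real_derivative
           (\<Sum>e\<in>E. g' e * tree_number_grad V E (g t\<^sub>0) e)) (at t\<^sub>0)"
proof -
  let ?S = "spanning_trees V E"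
  have sub: "T \<subseteq> E" if "T \<in> ?S" for T
    using that by (simp add: spanning_trees_def)
  have finS: "finite ?S"
    by (rule finite_subset[of _ "Pow E"]) (use sub assms(1) in auto)
  have "((\<lambda>t. \<Prod>e\<in>T. g t e) has_real_derivative
          (\<Sum>e\<in>T. g' e * (\<Prod>f\<in>T - {e}. g t\<^sub>0 f))) (at t\<^sub>0)" if "T \<in> ?S" for T
    by (rule has_field_derivative_prod) (use g sub that in auto)
  then have "((\<lambda>t. weighted_tree_number V E (g t)) has_real_derivative
               (\<Sum>T\<in>?S. \<Sum>e\<in>T. g' e * (\<Prod>f\<in>T - {e}. g t\<^sub>0 f))) (at t\<^sub>0)"
    unfolding weighted_tree_number_def by (intro DERIV_sum)
  also have "(\<Sum>T\<in>?S. \<Sum>e\<in>T. g' e * (\<Prod>f\<in>T - {e}. g t\<^sub>0 f)) =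
             (\<Sum>T\<in>?S. \<Sum>e | e \<in> E \<and> e \<in> T. g' e * (\<Prod>f\<in>T - {e}. g t\<^sub>0 f))"
    by (intro sum.cong refl) (use sub in auto)
  also have "\<dots> = (\<Sum>e\<in>E. \<Sum>T | T \<in> ?S \<and> e \<in> T. g' e * (\<Prod>f\<in>T - {e}. g t\<^sub>0 f))"
    by (rule sum.swap_restrict[OF finS assms(1)])
  also have "\<dots> = (\<Sum>e\<in>E. g' e * tree_number_grad V E (g t\<^sub>0) e)"
    by (simp add: tree_number_grad_def sum_distrib_left)
  finally show ?thesis .
qed

lemma tree_number_partial_eq_grad:
  assumes "finite E" "e \<in> E"
  shows "tree_number_partial V E e x = tree_number_grad V E x e"
proof -
  have "((\<lambda>t. (x(e := t)) f) has_real_derivative (if f = e then 1 else 0)) (at (x e))" for f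
    by auto
  from has_real_derivative_weighted_tree_number[where g = "\<lambda>t. x(e := t)", OF assms(1) this]
  have "((\<lambda>t. weighted_tree_number V E (x(e := t))) has_real_derivative
          (\<Sum>f\<in>E. (if f = e then 1 else 0) * tree_number_grad V E x f)) (at (x e))"
    by simp
  also have "(\<Sum>f\<in>E. (if f = e then 1 else 0) * tree_number_grad V E x f) =
             (\<Sum>f\<in>E. if f = e then tree_number_grad V E x f else 0)"
    by (intro sum.cong) auto
  also have "\<dots> = tree_number_grad V E x e"
    using assms by simp
  finally show ?thesis
    unfolding tree_number_partial_def by (rule DERIV_imp_deriv)
qed

lemma has_real_derivative_weighted_tree_number_direction:
  assumes "finite E"
  shows "((\<lambda>t. weighted_tree_number V E (\<lambda>e. x e + t * y e)) has_real_derivative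
           (\<Sum>e\<in>E. y e * tree_number_partial V E e x)) (at 0)"
proof -
  have "((\<lambda>t. x e + t * y e) has_real_derivative y e) (at 0)" for e
    by (auto intro!: derivative_eq_intros)
  from has_real_derivative_weighted_tree_number[where g = "\<lambda>t e. x e + t * y e", OF assms this]
  show ?thesis
    by (simp add: tree_number_partial_eq_grad[OF assms])
qed

text \<open>The orthogonal complement of the sum-zero hyperplane is spanned by the all-ones vector;
  differences of two unit vectors suffice as test vectors.\<close>

lemma orthogonal_sum_zero_iff_constant:
  fixes c :: "'b \<Rightarrow> real"
  assumes "finite A"
  shows "(\<forall>y. (\<Sum>a\<in>A. y a) = 0 \<longrightarrow> (\<Sum>a\<in>A. y a * c a) = 0) \<longleftrightarrow>
         (\<forall>a\<in>A. \<forall>b\<in>A. c a = c b)"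
proof (intro iffI ballI allI impI)
  fix a b
  assume orth: "\<forall>y. (\<Sum>a\<in>A. y a) = 0 \<longrightarrow> (\<Sum>a\<in>A. y a * c a) = 0"
    and ab: "a \<in> A" "b \<in> A"
  \<comment> \<open>The unit vector at \<open>a\<close> minus that at \<open>b\<close>. Pairing it
    with \<open>w\<close> gives \<open>w a - w b\<close>: the choice \<open>w = 1\<close> shows that
    \<open>y\<close> is admissible, and \<open>w = c\<close> gives the claim.\<close>
  define y where "y i = (of_bool (i = a) - of_bool (i = b) :: real)" for i
  have y: "(\<Sum>i\<in>A. y i * w i) = w a - w b" for w
    using assms ab
    by (simp add: y_def left_diff_distrib sum_subtractf)
  have "(\<Sum>i\<in>A. y i) = 0"
    using y[of "\<lambda>_. 1"] by simp
  with orth have "(\<Sum>i\<in>A. y i * c i) = 0"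
    by blast
  with y[of c] show "c a = c b"
    by simp
next
  fix y :: "'b \<Rightarrow> real"
  assume const: "\<forall>a\<in>A. \<forall>b\<in>A. c a = c b" and y: "(\<Sum>a\<in>A. y a) = 0"
  show "(\<Sum>a\<in>A. y a * c a) = 0"
  proof (cases "A = {}")
    case False
    then obtain b where "b \<in> A" by blast
    with const have "(\<Sum>a\<in>A. y a * c a) = (\<Sum>a\<in>A. y a * c b)"
      by (intro sum.cong refl arg_cong2[where f = times]) blast
    also have "\<dots> = 0"
      using y by (simp flip: sum_distrib_right)
    finally show ?thesis .
  qed simp
qed

theorem proposition2p3:
  fixes V :: "'a set" and E :: "'a set set" and x :: "'a set \<Rightarrow> real"
  assumes "finite V" and "simple_graph V E" and "connected_graph V E"
    and "x \<in> edge_polytope E"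
    and "weighted_tree_number V E x \<noteq> 0"
  shows "critical_tree_number V E x \<longleftrightarrow>
    (\<forall>e\<in>E. \<forall>f\<in>E. effective_resistance V E x e = effective_resistance V E x f)"
proof -
  have finE: "finite E"
    using assms(1,2) by (rule finite_simple_graph_edges)
  \<comment> \<open>The directional derivative always exists and is unique, so it is 0 exactly when
    the inner product is.\<close>
  have "((\<lambda>t. weighted_tree_number V E (\<lambda>e. x e + t * y e)) has_real_derivative 0) (at 0) \<longleftrightarrow>
        (\<Sum>e\<in>E. y e * tree_number_partial V E e x) = 0" for y
    using has_real_derivative_weighted_tree_number_direction[OF finE, of V x y]
    by (auto dest: DERIV_unique)
  then have "critical_tree_number V E x \<longleftrightarrow>
      (\<forall>e\<in>E. \<forall>f\<in>E. tree_number_partial V E e x = tree_number_partial V E f x)"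
    using assms(4)
    by (simp only: critical_tree_number_def simp_thms orthogonal_sum_zero_iff_constant[OF finE])
  then show ?thesis
    using assms(5) by (simp add: effective_resistance_def)
qed

end
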